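(* Let $R$ be a Dedekind domain, let $P=(p)$ be a prime principal ideal of $R$, let $J$ be an ideal of $R$ with $J\not\subseteq P$, let $\alpha$ be a positive integer, and let $I=P^{\alpha}J$, where $I$ is nonzero and $R/I$ is finite. If $\alpha>1$ or if $p-1\notin J$ and $p+1\notin J$, then $G_{R/I}$ has a cycle of length $4$.
   Context: $G_{R/I}$ is the unitary Cayley graph of $R/I$: vertex set $R/I$, with $a+I$, $b+I$ adjacent iff $a-b+I$ is a unit of $R/I$. *)

theory Defs
  imports "HOL-Algebra.Algebra" "Graph_Theory.Pair_Digraph"
begin

text \<open>
  The ideal-theoretic definition: every nonzero proper ideal is a product of (finitely many)
  prime ideals. Fields are included.
\<close>

locale dedekind_domain = domain R for R :: "('a, 'b) ring_scheme" (structure) +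
  assumes prime_factorization:
    "\<lbrakk>ideal A R; A \<noteq> {\<zero>}; A \<noteq> carrier R\<rbrakk>
      \<Longrightarrow> \<exists>Ps. (\<forall>Q \<in> set Ps. primeideal Q R) \<and> A = foldr (ideal_prod R) Ps (carrier R)"

text \<open>
  An undirected edge is represented by the two arcs in opposite directions. If \<open>S\<close> is not the
  zero ring, then \<open>\<zero>\<close> is not a unit, so the graph has no loops.
\<close>

definition unitary_cayley_graph :: "('a, 'b) ring_scheme \<Rightarrow> 'a pair_pre_digraph" where
  "unitary_cayley_graph S =
    \<lparr> pverts = carrier S,
      parcs = {(a, b). a \<in> carrier S \<and> b \<in> carrier S \<and> a \<ominus>\<^bsub>S\<^esub> b \<in> Units S} \<rparr>"

text \<open>
  The predicate \<open>cycle\<close> concerns directed cycles, so in a symmetric digraph every edge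
  gives one of length 2 (out and back). From length 3 on, the cycles of the symmetric digraph are
  exactly the cycles of the undirected graph, since their vertices are pairwise distinct.
\<close>

definition has_cycle_of_length :: "'a pair_pre_digraph \<Rightarrow> nat \<Rightarrow> bool" where
  "has_cycle_of_length G n \<longleftrightarrow> (\<exists>c. pre_digraph.cycle (with_proj G) c \<and> length c = n)"

end

(* With S = R/I, a nonzero x in S with x^2 = 0 gives the 4-cycle 0, 1, x, 1 + x, and a unit w
   other than 1 and -1 gives the 4-cycle 0, 1, 1 + w, w. If \<alpha> > 1, such an x exists because
   P^(\<alpha>-1) J strictly contains I, by cancellation of the nonzero element p. If \<alpha> = 1,
   then p is invertible modulo J, and the Chinese remainder theorem gives a unit w with w = -1
   modulo P and w = p modulo J; the hypothesis on p - 1 and p + 1 says that w is neither 1 nor -1. *)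
theory Submission
  imports Defs
begin

section \<open>Four-cycles in the unitary Cayley graph of a commutative ring\<close>

lemma has_cycle_of_length_4I:
  assumes "distinct [a, b, c, d]" "a \<in> pverts G"
    and "(a, b) \<in> parcs G" "(b, c) \<in> parcs G" "(c, d) \<in> parcs G" "(d, a) \<in> parcs G"
  shows "has_cycle_of_length G 4"
  unfolding has_cycle_of_length_def
proof (intro exI conjI)
  \<comment> \<open>\<open>cycle\<close> asks for a closed walk of arcs whose vertices after the
    first are distinct; here these are \<open>b\<close>, \<open>c\<close>, \<open>d\<close>,
    \<open>a\<close>.\<close>
  show "pre_digraph.cycle (with_proj G) [(a, b), (b, c), (c, d), (d, a)]"
    unfolding pre_digraph.cycle_def pre_digraph.awalk_def
      cas_with_proj_eq awalk_verts_with_proj_eq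
    using assms by (intro exI[of _ a]) auto
qed simp

context cring
begin

lemma unitary_cayley_graph_4_cycle:
  assumes "distinct [a, b, c, d]" "{a, b, c, d} \<subseteq> carrier R"
    and "a \<ominus> b \<in> Units R" "b \<ominus> c \<in> Units R" "c \<ominus> d \<in> Units R" "d \<ominus> a \<in> Units R"
  shows "has_cycle_of_length (unitary_cayley_graph R) 4"
  using assms
  by (intro has_cycle_of_length_4I[of a b c d]) (auto simp: unitary_cayley_graph_def)

lemma UnitsI:
  assumes "x \<in> carrier R" "y \<in> carrier R" "x \<otimes> y = \<one>"
  shows "x \<in> Units R"
  using assms m_comm[of x y] by (auto simp: Units_def)

lemma Units_a_inv:
  assumes "u \<in> Units R" shows "\<ominus> u \<in> Units R"
  using assms by (intro UnitsI[of _ "\<ominus> (inv u)"]) (simp_all add: l_minus r_minus Units_closed)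

text \<open>Consecutive differences around the cycle are, up to sign, alternately 1 and
  \<open>u\<close>. The two inequalities on \<open>u\<close> separate the opposite vertices.\<close>

lemma unitary_cayley_graph_4_cycle_of_unit:
  assumes u: "u \<in> Units R" and "u \<noteq> \<one>" "u \<oplus> \<one> \<noteq> \<zero>" "\<one> \<noteq> \<zero>"
  shows "has_cycle_of_length (unitary_cayley_graph R) 4"
proof (rule unitary_cayley_graph_4_cycle)
  have uc: "u \<in> carrier R" using u by (rule Units_closed)
  have "u \<noteq> \<zero>"
    using assms(4) u by (metis Units_r_inv_ex l_null)
  moreover have "\<one> \<oplus> u \<noteq> \<zero>" using assms(3) uc by (simp add: a_comm)
  ultimately show "distinct [\<zero>, \<one>, \<one> \<oplus> u, u]"
    using assms uc by (auto simp: a_comm)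
  show "{\<zero>, \<one>, \<one> \<oplus> u, u} \<subseteq> carrier R" using uc by simp
  have "\<zero> \<ominus> \<one> = \<ominus> \<one>" "\<one> \<ominus> (\<one> \<oplus> u) = \<ominus> u" "\<one> \<oplus> u \<ominus> u = \<one>" "u \<ominus> \<zero> = u"
    using uc by algebra+
  then show "\<zero> \<ominus> \<one> \<in> Units R" "\<one> \<ominus> (\<one> \<oplus> u) \<in> Units R" "\<one> \<oplus> u \<ominus> u \<in> Units R" "u \<ominus> \<zero> \<in> Units R"
    using u by (simp_all add: Units_a_inv)
qed

text \<open>Since (1 - x)(1 + x) = 1, both factors are units; the other two differences on the cycle
  are -1. Opposite vertices differ by \<open>x\<close>.\<close>

lemma unitary_cayley_graph_4_cycle_of_square_zero:
  assumes x: "x \<in> carrier R" "x \<noteq> \<zero>" and sq: "x \<otimes> x = \<zero>"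
  shows "has_cycle_of_length (unitary_cayley_graph R) 4"
proof (rule unitary_cayley_graph_4_cycle)
  have nz: "\<one> \<noteq> \<zero>" using x by (metis l_null l_one)
  have minus: "\<one> \<ominus> x \<in> Units R"
  proof (rule UnitsI)
    have "(\<one> \<ominus> x) \<otimes> (\<one> \<oplus> x) = \<one> \<ominus> x \<otimes> x" using x by algebra
    then show "(\<one> \<ominus> x) \<otimes> (\<one> \<oplus> x) = \<one>" using sq by (simp add: minus_eq)
  qed (use x in auto)
  have plus: "\<one> \<oplus> x \<in> Units R"
  proof (rule UnitsI)
    have "(\<one> \<oplus> x) \<otimes> (\<one> \<ominus> x) = \<one> \<ominus> x \<otimes> x" using x by algebra
    then show "(\<one> \<oplus> x) \<otimes> (\<one> \<ominus> x) = \<one>" using sq by (simp add: minus_eq)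
  qed (use x in auto)
  have zero_nonunit: "\<zero> \<notin> Units R" using nz by (metis Units_r_inv_ex l_null)
  have "\<one> \<noteq> x" using sq nz by auto
  moreover have "\<one> \<oplus> x \<noteq> \<zero>" using plus zero_nonunit by auto
  ultimately show "distinct [\<zero>, \<one>, x, \<one> \<oplus> x]"
    using x nz by (auto simp: a_comm)
  show "{\<zero>, \<one>, x, \<one> \<oplus> x} \<subseteq> carrier R" using x by simp
  have "\<zero> \<ominus> \<one> = \<ominus> \<one>" "x \<ominus> (\<one> \<oplus> x) = \<ominus> \<one>" "\<one> \<oplus> x \<ominus> \<zero> = \<one> \<oplus> x"
    using x by algebra+
  then show "\<zero> \<ominus> \<one> \<in> Units R" "\<one> \<ominus> x \<in> Units R" "x \<ominus> (\<one> \<oplus> x) \<in> Units R" "\<one> \<oplus> x \<ominus> \<zero> \<in> Units R"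
    using minus plus by (simp_all add: Units_a_inv)
qed

section \<open>Products with a principal ideal and powers of ideals\<close>

lemma cgenideal_prod_eq:
  assumes p: "p \<in> carrier R" and A: "ideal A R"
  shows "(PIdl p) \<cdot> A = (\<lambda>a. p \<otimes> a) ` A"
proof
  interpret A: ideal A R by (rule A)
  show "(PIdl p) \<cdot> A \<subseteq> (\<lambda>a. p \<otimes> a) ` A"
  proof
    fix s assume "s \<in> (PIdl p) \<cdot> A"
    then show "s \<in> (\<lambda>a. p \<otimes> a) ` A"
    proof (induct s rule: ideal_prod.induct)
      case (prod i a)
      then obtain r where r: "r \<in> carrier R" "i = r \<otimes> p" by (auto simp: cgenideal_def)
      then have "i \<otimes> a = p \<otimes> (r \<otimes> a)"
        using p prod A.Icarr by (simp add: m_ac)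
      then show ?case using A.I_l_closed prod r by blast
    next
      \<comment> \<open>A finite sum of products collapses to a single product, because the common
        factor \<open>p\<close> can be pulled out.\<close>
      case (sum s t)
      then obtain a b where "a \<in> A" "b \<in> A" "s = p \<otimes> a" "t = p \<otimes> b" by blast
      then have "s \<oplus> t = p \<otimes> (a \<oplus> b)" "a \<oplus> b \<in> A"
        using p A.Icarr by (simp_all add: r_distr)
      then show ?case by blast
    qed
  qed
  show "(\<lambda>a. p \<otimes> a) ` A \<subseteq> (PIdl p) \<cdot> A"
    using cgenideal_self[OF p] by (auto intro: ideal_prod.prod)
qed

text \<open>Powers are taken in \<open>ideals_set R\<close>, the commutative monoid of ideals under
  multiplication, with unit \<open>carrier R\<close>.\<close>

lemma ideal_pow_is_ideal:
  assumes "ideal P R"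
  shows "ideal (P [^]\<^bsub>ideals_set R\<^esub> (n::nat)) R"
proof -
  interpret M: comm_monoid "ideals_set R" by (rule ideals_set_is_comm_monoid)
  show ?thesis
    using M.nat_pow_closed[of P n] assms by (simp add: ideals_set_def)
qed

lemma ideal_pow_Suc:
  assumes "ideal P R"
  shows "P [^]\<^bsub>ideals_set R\<^esub> Suc n = P \<cdot> (P [^]\<^bsub>ideals_set R\<^esub> n)"
proof -
  interpret M: comm_monoid "ideals_set R" by (rule ideals_set_is_comm_monoid)
  show ?thesis
    using M.nat_pow_Suc2[of P n] assms by (simp add: ideals_set_def)
qed

lemma ideal_pow_0: "P [^]\<^bsub>ideals_set R\<^esub> (0::nat) = carrier R"
  by (simp add: ideals_set_def)

section \<open>A unit from complementary idempotents, and powers congruent to 1 modulo a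
  prime\<close>

text \<open>Here \<open>p r\<close> and \<open>j\<close> are complementary idempotents; \<open>p - j\<close> is \<open>p\<close> in the first factor
  and \<open>-1\<close> in the second.\<close>
lemma diff_in_Units:
  assumes carr: "p \<in> carrier R" "r \<in> carrier R" "j \<in> carrier R"
    and "p \<otimes> r \<oplus> j = \<one>" and "p \<otimes> j = \<zero>"
  shows "p \<ominus> j \<in> Units R"
proof (rule UnitsI)
  \<comment> \<open>The inverse is found factor by factor: p r r inverts \<open>p\<close> where p r
    acts as identity, and -j is its own inverse where \<open>j\<close> does. As p j = 0, the product
    equals (p r + j)^2 = 1.\<close>
  have "(p \<ominus> j) \<otimes> (p \<otimes> r \<otimes> r \<ominus> j) = (p \<otimes> r) \<otimes> (p \<otimes> r) \<oplus> j \<otimes> j \<ominus> p \<otimes> j \<ominus> (p \<otimes> j) \<otimes> (r \<otimes> r)"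
    using carr by algebra
  moreover have "(p \<otimes> r \<oplus> j) \<otimes> (p \<otimes> r \<oplus> j) = (p \<otimes> r) \<otimes> (p \<otimes> r) \<oplus> j \<otimes> j \<oplus> (p \<otimes> j) \<otimes> (r \<oplus> r)"
    using carr by algebra
  ultimately show "(p \<ominus> j) \<otimes> (p \<otimes> r \<otimes> r \<ominus> j) = \<one>"
    using assms by (simp add: minus_eq)
qed (use carr in auto)

text \<open>Pigeonhole on the powers of \<open>a\<close> makes \<open>a\<^sup>m (1 - a\<^sup>k)\<close> vanish modulo \<open>I\<close> for some \<open>k > 0\<close>.\<close>
lemma power_congruent_one_mod_prime:
  assumes P: "primeideal P R" and I: "ideal I R" and IP: "I \<subseteq> P"
    and fin: "finite (carrier (R Quot I))"
    and a: "a \<in> carrier R" "a \<notin> P"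
  obtains k :: nat where "k > 0" "\<one> \<ominus> a [^] k \<in> P"
proof -
  interpret P: primeideal P R by (rule P)
  interpret I: ideal I R by (rule I)
  have "range (\<lambda>n::nat. I +> a [^] n) \<subseteq> carrier (R Quot I)"
    using a by (auto simp: FactRing_def intro: a_rcosetsI[OF I.a_subset])
  then have "finite (range (\<lambda>n::nat. I +> a [^] n))"
    using fin finite_subset by blast
  then have "\<not> inj (\<lambda>n::nat. I +> a [^] n)"
    using finite_imageD infinite_UNIV_nat by blast
  then obtain m n :: nat where mn: "m < n" "I +> a [^] m = I +> a [^] n"
    unfolding inj_def by (metis linorder_neqE_nat)
  define k where "k = n - m"
  have n: "n = m + k" "k > 0" using mn by (auto simp: k_def)
  have "a [^] m \<ominus> a [^] n \<in> I"
    using mn a quotient_eq_iff_same_a_r_cos[OF I] by simp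
  moreover have "a [^] m \<ominus> a [^] n = a [^] m \<otimes> (\<one> \<ominus> a [^] k)"
  proof -
    have "a [^] m \<ominus> a [^] m \<otimes> a [^] k = a [^] m \<otimes> (\<one> \<ominus> a [^] k)"
      using nat_pow_closed[OF a(1), of m] nat_pow_closed[OF a(1), of k] by algebra
    then show ?thesis using a by (simp add: n nat_pow_mult)
  qed
  \<comment> \<open>Primality keeps every power of \<open>a\<close> out of \<open>P\<close>, so the
    other factor must lie in \<open>P\<close>.\<close>
  moreover have "a [^] i \<notin> P" for i :: nat
  proof (induct i)
    case 0
    then show ?case using P.one_imp_carrier P.I_notcarr by auto
  next
    case (Suc i)
    then show ?case using a P.I_prime[of "a [^] i" a] by auto
  qed
  ultimately have "\<one> \<ominus> a [^] k \<in> P"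
    using IP P.I_prime[of "a [^] m" "\<one> \<ominus> a [^] k"] a by auto
  then show ?thesis using that n by blast
qed

end

section \<open>Cancellation of a principal factor\<close>

lemma (in domain) cgenideal_prod_cancel:
  assumes "p \<in> carrier R" "p \<noteq> \<zero>" "ideal A R" "ideal B R" "(PIdl p) \<cdot> A = (PIdl p) \<cdot> B"
  shows "A = B"
proof -
  have "inj_on (\<lambda>a. p \<otimes> a) (carrier R)"
    using assms by (auto intro!: inj_onI simp: m_lcancel)
  moreover have "A \<subseteq> carrier R" "B \<subseteq> carrier R"
    using assms by (auto dest: ideal.Icarr)
  \<comment> \<open>Both products are images, of \<open>A\<close> and of \<open>B\<close>, under
    this injective map.\<close>
  ultimately show ?thesis
    using assms by (simp add: cgenideal_prod_eq inj_on_image_eq_iff)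
qed

text \<open>With P = \<open>PIdl p\<close>, cancelling \<open>p\<close> once per power would reduce
  an equality to P J = J. This fails, as P J lies in P and \<open>J\<close> does not.\<close>

lemma (in domain) ideal_pow_prod_strict:
  fixes n :: nat
  assumes p: "p \<in> carrier R" "p \<noteq> \<zero>" and J: "ideal J R" "\<not> J \<subseteq> PIdl p"
  shows "(PIdl p) \<cdot> (((PIdl p) [^]\<^bsub>ideals_set R\<^esub> n) \<cdot> J) \<noteq> ((PIdl p) [^]\<^bsub>ideals_set R\<^esub> n) \<cdot> J"
proof (induct n)
  note P = cgenideal_ideal[OF p(1)]
  case 0
  have "carrier R \<cdot> J = J"
    using ideal_prod_one[OF J(1)] ideal_prod_commute[OF oneideal J(1)] by simp
  then show ?case
    using ideal_prod_inter[OF P J(1)] J(2) unfolding ideal_pow_0 by auto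
next
  note P = cgenideal_ideal[OF p(1)]
  case (Suc n)
  note Q = ideal_pow_is_ideal[OF P, of n]
  have "((PIdl p) [^]\<^bsub>ideals_set R\<^esub> Suc n) \<cdot> J = (PIdl p) \<cdot> (((PIdl p) [^]\<^bsub>ideals_set R\<^esub> n) \<cdot> J)"
    by (simp only: ideal_pow_Suc[OF P] ideal_prod_assoc[OF P Q J(1)])
  then show ?case
    using Suc cgenideal_prod_cancel[OF p] ideal_prod_is_ideal P Q J(1) by metis
qed

section \<open>The quotient by \<open>I\<close>, for exponent above 1 and exponent 1\<close>

theorem theorem4p6:
  fixes R :: "('a, 'b) ring_scheme" (structure)
    and p :: 'a and P J I :: "'a set" and \<alpha> :: nat
  assumes "dedekind_domain R"
    and "p \<in> carrier R" and "P = PIdl p" and "primeideal P R"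
    and "ideal J R" and "\<not> J \<subseteq> P"
    and "\<alpha> > 0"
    and "I = (P [^]\<^bsub>ideals_set R\<^esub> \<alpha>) \<cdot>\<^bsub>R\<^esub> J"
    and "I \<noteq> {\<zero>}" and "finite (carrier (R Quot I))"
    and "\<alpha> > 1 \<or> (p \<ominus> \<one> \<notin> J \<and> p \<oplus> \<one> \<notin> J)"
  shows "has_cycle_of_length (unitary_cayley_graph (R Quot I)) 4"
proof -
  interpret dedekind_domain R by (rule assms(1))
  interpret P: primeideal P R by (rule assms(4))
  interpret J: ideal J R by (rule assms(5))
  note P = P.ideal_axioms and J = J.ideal_axioms and p = assms(2)
  obtain n where \<alpha>: "\<alpha> = Suc n" using assms(7) gr0_implies_Suc by blast
  define Q where "Q = P [^]\<^bsub>ideals_set R\<^esub> n"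
  \<comment> \<open>\<open>K\<close> is \<open>I\<close> with one factor \<open>P\<close> removed.
    It supplies the square-zero element when \<open>n\<close> is positive and equals
    \<open>J\<close> when \<open>n\<close> is 0.\<close>
  define K where "K = Q \<cdot> J"
  have Q: "ideal Q R" unfolding Q_def by (rule ideal_pow_is_ideal[OF P])
  have K: "ideal K R" unfolding K_def by (rule ideal_prod_is_ideal[OF Q J])
  have I_eq: "I = P \<cdot> K"
    unfolding assms(8) \<alpha> ideal_pow_Suc[OF P] K_def Q_def[symmetric]
    by (rule ideal_prod_assoc[OF P Q J])
  have I: "ideal I R" unfolding I_eq by (rule ideal_prod_is_ideal[OF P K])
  interpret I: ideal I R by (rule I)
  interpret S: cring "R Quot I" by (rule I.quotient_is_cring[OF is_cring])
  interpret h: ring_hom_cring R "R Quot I" "(+>) I"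
    by (rule I.rcos_ring_hom_cring[OF is_cring])
  have I_sub: "I \<subseteq> P" "I \<subseteq> J"
    using ideal_prod_inter[OF P K] ideal_prod_inter[OF Q J] by (auto simp: I_eq K_def)
  have zero_iff: "I +> x = \<zero>\<^bsub>R Quot I\<^esub> \<longleftrightarrow> x \<in> I" if "x \<in> carrier R" for x
    unfolding FactRing_def ring_record_simps using that I.a_rcos_const I.a_rcos_self by metis
  have eq_iff: "I +> x = I +> y \<longleftrightarrow> x \<ominus> y \<in> I" if "x \<in> carrier R" "y \<in> carrier R" for x y
    using quotient_eq_iff_same_a_r_cos[OF I that] by simp
  \<comment> \<open>Otherwise \<open>P\<close>, and with it \<open>I\<close>, would be the zero
    ideal.\<close>
  have "p \<noteq> \<zero>"
  proof
    assume "p = \<zero>"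
    have "P \<subseteq> {\<zero>}"
    proof
      fix x assume "x \<in> P"
      then obtain r where "r \<in> carrier R" "x = r \<otimes> p"
        unfolding assms(3) cgenideal_def by blast
      then show "x \<in> {\<zero>}" using \<open>p = \<zero>\<close> by simp
    qed
    then show False using I_sub(1) I.zero_closed assms(9) by blast
  qed
  show ?thesis
  proof (cases n)
    case (Suc m)
    have "I \<noteq> K"
      using ideal_pow_prod_strict[OF p \<open>p \<noteq> \<zero>\<close> J] assms(3,6) by (simp add: I_eq K_def Q_def)
    moreover have "I \<subseteq> K" using ideal_prod_inter[OF P K] by (simp add: I_eq)
    ultimately obtain x where x: "x \<in> K" "x \<notin> I" by blast
    have xc: "x \<in> carrier R" using x K by (auto dest: ideal.Icarr)
    \<comment> \<open>As \<open>n\<close> is positive, \<open>K\<close> still contains a factor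
      \<open>P\<close>; hence x x lies in P K = I.\<close>
    have "K \<subseteq> P"
      using ideal_prod_inter[OF Q J] ideal_prod_inter[OF P ideal_pow_is_ideal[OF P, of m]]
      unfolding K_def Q_def Suc ideal_pow_Suc[OF P] by auto
    then have "x \<otimes> x \<in> I" using x by (auto simp: I_eq intro: ideal_prod.prod)
    then show ?thesis
      using S.unitary_cayley_graph_4_cycle_of_square_zero[of "I +> x"] x xc zero_iff
      by (simp flip: h.hom_mult)
  next
    case 0
    have "K = J"
      using ideal_prod_one[OF J] ideal_prod_commute[OF oneideal J]
      unfolding K_def Q_def 0 ideal_pow_0 by simp
    have pm: "p \<ominus> \<one> \<notin> J" "p \<oplus> \<one> \<notin> J" using assms(11) \<alpha> 0 by auto
    obtain a where a: "a \<in> J" "a \<notin> P" using assms(6) by blast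
    have ac: "a \<in> carrier R" using a J.Icarr by blast
    \<comment> \<open>The power a^k is 1 modulo \<open>P\<close>, and it stays in \<open>J\<close>
      because \<open>k\<close> is positive. This is the element needed for the Chinese remainder
      argument.\<close>
    obtain k :: nat where k: "k > 0" "\<one> \<ominus> a [^] k \<in> P"
      using power_congruent_one_mod_prime[OF assms(4) I I_sub(1) assms(10) ac a(2)] .
    define j where "j = a [^] k"
    have "j = a [^] (k - 1) \<otimes> a" using k by (metis Suc_diff_1 j_def nat_pow_Suc)
    then have jJ: "j \<in> J" using a ac J.I_l_closed by simp
    have jc: "j \<in> carrier R" using jJ J.Icarr by blast
    obtain r where r: "r \<in> carrier R" "\<one> \<ominus> j = r \<otimes> p"
      using k(2) unfolding assms(3) cgenideal_def j_def by blast
    have "p \<otimes> r \<oplus> j = r \<otimes> p \<oplus> j" using p r(1) by (simp add: m_comm)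
    also have "\<dots> = \<one> \<ominus> j \<oplus> j" by (simp only: r(2))
    also have "\<dots> = \<one>" using jc by algebra
    finally have "p \<otimes> r \<oplus> j = \<one>" .
    \<comment> \<open>So p j vanishes in the quotient, which together with p r + j = 1 is what
      \<open>diff_in_Units\<close> asks for.\<close>
    moreover have "p \<otimes> j \<in> I"
      unfolding I_eq \<open>K = J\<close> assms(3) using cgenideal_self[OF p] jJ by (rule ideal_prod.prod)
    ultimately have "(I +> p) \<ominus>\<^bsub>R Quot I\<^esub> (I +> j) \<in> Units (R Quot I)"
      using p r(1) jc zero_iff
      by (intro S.diff_in_Units[of _ "I +> r"]) (simp_all flip: h.hom_mult h.hom_add h.hom_one)
    moreover define w where "w = p \<ominus> j"
    ultimately have unit: "I +> w \<in> Units (R Quot I)"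
      using p jc by (simp add: minus_eq S.minus_eq)
    have wc: "w \<in> carrier R" using p jc by (simp add: w_def)
    \<comment> \<open>Since \<open>w\<close> and \<open>p\<close> differ by \<open>j\<close> in
      \<open>J\<close>, the hypotheses on p - 1 and p + 1 carry over to w - 1 and w + 1.\<close>
    have shift: "x \<notin> J" if "x \<oplus> j \<notin> J" for x
      using that jJ by auto
    have "w \<ominus> \<one> \<oplus> j = p \<ominus> \<one>" "w \<oplus> \<one> \<oplus> j = p \<oplus> \<one>"
      unfolding w_def using p jc by algebra+
    then have "w \<ominus> \<one> \<notin> J" "w \<oplus> \<one> \<notin> J"
      using shift[of "w \<ominus> \<one>"] shift[of "w \<oplus> \<one>"] pm by simp_all
    then have "w \<ominus> \<one> \<notin> I" "w \<oplus> \<one> \<notin> I"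
      using I_sub(2) by blast+
    then have "I +> w \<noteq> I +> \<one>" "I +> (w \<oplus> \<one>) \<noteq> \<zero>\<^bsub>R Quot I\<^esub>"
      using wc by (simp_all only: eq_iff zero_iff a_closed one_closed not_False_eq_True)
    moreover have "I +> \<one> \<noteq> \<zero>\<^bsub>R Quot I\<^esub>"
      using zero_iff[OF one_closed] I_sub(1) P.one_imp_carrier P.I_notcarr by blast
    ultimately show ?thesis
      using S.unitary_cayley_graph_4_cycle_of_unit[OF unit] wc by simp
  qed
qed

end
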